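(* Let $G$ be an alternating dimap and let $e,f$ be distinct edges of $G$. If $f\neq\sigma_{G,\omega}(e)$ then $$G[1]e[\omega]f = G[\omega]f[1]e,$$ where $H[\mu]e$ denotes the $\mu$-reduction of $H$ by $e$ and successive reductions are applied from left to right.
   Context: An \emph{alternating dimap} is a finite directed graph (loops and multiple edges allowed) without isolated vertices, 2-cell-embedded in a disjoint union of oriented surfaces (orientable 2-manifolds, one for each component), such that around each vertex the incident edges are directed alternately into and out of the vertex. The empty alternating dimap is allowed. All edges around a face go in the same direction; a face is a \emph{c-face} (clockwise) or \emph{a-face} (anticlockwise) accordingly. An \emph{in-star} is the set of all edges directed into some vertex. Each edge $e$ lies in exactly one c-face $C(e)$, one a-face $A(e)$ and one in-star $I(e)$. The \emph{left successor} (resp. \emph{right successor}) of $e$ is the next edge after $e$ going around $A(e)$ (resp. $C(e)$) in the direction of $e$. Let $\omega=\exp(2\pi i/3)$. The permutations $\sigma_{G,1},\sigma_{G,\omega},\sigma_{G,\omega^2}$ of $E(G)$ (subscript $G$ omitted when clear) send $e$ to the next edge in clockwise order around $I(e)$, $A(e)$, $C(e)$ respectively (outgoing edges are skipped in going around an in-star). So the left successor of $e$ is $\sigma_\omega^{-1}(e)$ and the right successor is $\sigma_{\omega^2}(e)$. They satisfy $\sigma_1\sigma_\omega\sigma_{\omega^2}=\mathrm{id}$ (rightmost applied first), and alternating dimaps correspond bijectively to triples of permutations of a finite set satisfying this identity. Two alternating dimaps are equal when they have the same edge set and the same triple. \emph{Minor operations.} Let $e$ be an edge from $u$ to $v$.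 1-reduction $G[1]e$ (contraction): if $e$ is not a loop, delete $e$ and identify its endpoints, preserving the order of edges and faces around vertices; if $e$ alone forms an a-face or a c-face, delete $e$; if $e$ is any other loop, with cyclic order of edge-ends around $v$ being $e$ (directed in)$,a_1,b_1,\ldots,a_k,b_k,e$ (directed out)$,c_1,d_1,\ldots,c_l,d_l$, delete $e$ and replace $v$ by two vertices $v_1,v_2$, with the ends $a_i,b_i$ reattached to $v_1$ and the ends $c_i,d_i$ to $v_2$, in the induced cyclic orders. $\omega$-reduction $G[\omega]e$: delete $e$ and, if the left successor $g$ of $e$ is not $e$ itself, change the tail of $g$ from $v$ to $u$ so that $g$ takes the place of $e,g$ in $A(e)$. A vertex left without edges disappears. Equivalently, writing $\pi\setminus e$ for the permutation of $E\setminus\{e\}$ obtained from $\pi$ by removing $e$ from its cycle: in $G[1]e$, $\sigma_\omega$ and $\sigma_{\omega^2}$ become $\sigma_\omega\setminus e$ and $\sigma_{\omega^2}\setminus e$; in $G[\omega]e$, $\sigma_1$ and $\sigma_\omega$ become $\sigma_1\setminus e$ and $\sigma_\omega\setminus e$; in each case the third permutation is determined by the product identity. *)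

theory Defs
  imports "HOL-Combinatorics.Permutations"
begin

text \<open>
  Write \<open>w\<close> for the cube root of unity \<open>exp (2 * pi * i / 3)\<close>. An alternating dimap is given by
  its edge set and its three permutations: \<open>sig_1\<close>, \<open>sig_w\<close>, \<open>sig_w2\<close> send an edge to the next
  edge in clockwise order around its in-star, its a-face, its c-face, respectively. The vertices
  are the cycles of \<open>sig_1\<close>. Edge sets have to be recorded, because an edge may be a fixed point
  of all three permutations. As the permutations are the identity off the edge set, equality of
  records means: same edge set and same triple of permutations.
\<close>

record 'a dimap =
  edges :: "'a set"
  sig_1 :: "'a \<Rightarrow> 'a"
  sig_w :: "'a \<Rightarrow> 'a"
  sig_w2 :: "'a \<Rightarrow> 'a"

definition alternating_dimap :: "'a dimap \<Rightarrow> bool" where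
  "alternating_dimap G \<longleftrightarrow>
     finite (edges G) \<and>
     sig_1 G permutes edges G \<and> sig_w G permutes edges G \<and> sig_w2 G permutes edges G \<and>
     sig_1 G \<circ> sig_w G \<circ> sig_w2 G = id"

text \<open>The permutation with \<open>e\<close> removed from its cycle, extended by fixing \<open>e\<close>.\<close>

definition perm_del :: "('a \<Rightarrow> 'a) \<Rightarrow> 'a \<Rightarrow> 'a \<Rightarrow> 'a" where
  "perm_del p e = (\<lambda>x. if x = e then e else if p x = e then p e else p x)"

text \<open>
  Two of the permutations lose \<open>e\<close> from their cycles; the remaining one is the only solution of
  \<open>sig_1 \<circ> sig_w \<circ> sig_w2 = id\<close>. The description by edge-ends around vertices is proved below.
\<close>

definition reduce_1 :: "'a dimap \<Rightarrow> 'a \<Rightarrow> 'a dimap" where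
  "reduce_1 G e =
     \<lparr>edges = edges G - {e},
      sig_1 = inv (perm_del (sig_w G) e \<circ> perm_del (sig_w2 G) e),
      sig_w = perm_del (sig_w G) e,
      sig_w2 = perm_del (sig_w2 G) e\<rparr>"

definition reduce_w :: "'a dimap \<Rightarrow> 'a \<Rightarrow> 'a dimap" where
  "reduce_w G e =
     \<lparr>edges = edges G - {e},
      sig_1 = perm_del (sig_1 G) e,
      sig_w = perm_del (sig_w G) e,
      sig_w2 = inv (perm_del (sig_1 G) e \<circ> perm_del (sig_w G) e)\<rparr>"


subsection \<open>The reductions produce alternating dimaps\<close>

lemma perm_del_permutes:
  assumes "p permutes A"
  shows "perm_del p e permutes (A - {e})"
proof -
  have inj: "inj p" using assms by (rule permutes_inj)
  have surj: "surj p" using assms by (rule permutes_surj)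
  have "inj (perm_del p e)"
    unfolding inj_on_def perm_del_def using inj_eq[OF inj] by (auto split: if_splits)
  moreover have "\<exists>x. perm_del p e x = y" for y
  proof -
    obtain x where x: "p x = y" using surj by (metis surjD)
    obtain z where z: "p z = e" using surj by (metis surjD)
    show ?thesis
      using x z unfolding perm_del_def by metis
  qed
  moreover have "perm_del p e x = x" if "x \<notin> A - {e}" for x
    using that assms injD[OF inj, of x e] unfolding perm_del_def permutes_def by auto
  ultimately show ?thesis
    unfolding permutes_def by (metis injD)
qed

lemma inv_perm_del:
  assumes "p permutes A"
  shows "inv (perm_del p e) = perm_del (inv p) e"
proof (rule inv_unique_comp)
  show "perm_del p e \<circ> perm_del (inv p) e = id"
    by (auto simp: perm_del_def fun_eq_iff permutes_inverses[OF assms] permutes_inv_eq[OF assms])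
  show "perm_del (inv p) e \<circ> perm_del p e = id"
    by (auto simp: perm_del_def fun_eq_iff permutes_inverses[OF assms] inj_eq[OF permutes_inj[OF assms]])
qed

lemma alternating_dimap_reduce_1:
  assumes "alternating_dimap G"
  shows "alternating_dimap (reduce_1 G e)"
proof -
  let ?w = "perm_del (sig_w G) e" and ?w2 = "perm_del (sig_w2 G) e"
  have "?w permutes edges G - {e}" "?w2 permutes edges G - {e}"
    using assms unfolding alternating_dimap_def by (auto intro: perm_del_permutes)
  moreover from this have p: "?w \<circ> ?w2 permutes edges G - {e}"
    by (blast intro: permutes_compose)
  moreover have "inv (?w \<circ> ?w2) \<circ> (?w \<circ> ?w2) = id"
    using permutes_inv_o(2)[OF p] .
  ultimately show ?thesis
    using assms unfolding alternating_dimap_def reduce_1_def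
    by (simp add: permutes_inv comp_assoc)
qed

lemma alternating_dimap_reduce_w:
  assumes "alternating_dimap G"
  shows "alternating_dimap (reduce_w G e)"
proof -
  let ?s = "perm_del (sig_1 G) e" and ?w = "perm_del (sig_w G) e"
  have "?s permutes edges G - {e}" "?w permutes edges G - {e}"
    using assms unfolding alternating_dimap_def by (auto intro: perm_del_permutes)
  moreover from this have p: "?s \<circ> ?w permutes edges G - {e}"
    by (blast intro: permutes_compose)
  moreover have "(?s \<circ> ?w) \<circ> inv (?s \<circ> ?w) = id"
    using permutes_inv_o(1)[OF p] .
  ultimately show ?thesis
    using assms unfolding alternating_dimap_def reduce_w_def
    by (simp add: permutes_inv)
qed


subsection \<open>Edge-ends in clockwise order around the vertices\<close>

text \<open>
  Just clockwise of the head of \<open>e\<close> is the tail of its left successor; the edge whose right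
  successor is \<open>e\<close> has its head just clockwise of the tail of \<open>e\<close>.
\<close>

datatype 'a edge_end = Head 'a | Tail 'a

fun rotation :: "'a dimap \<Rightarrow> 'a edge_end \<Rightarrow> 'a edge_end" where
  "rotation G (Head e) = Tail (inv (sig_w G) e)"
| "rotation G (Tail e) = Head (inv (sig_w2 G) e)"

lemma inv_sig_w2:
  assumes "alternating_dimap G"
  shows "inv (sig_w2 G) = sig_1 G \<circ> sig_w G"
proof (rule inv_unique_comp)
  have a: "(sig_1 G \<circ> sig_w G) \<circ> sig_w2 G = id" and p: "sig_w2 G permutes edges G"
    using assms unfolding alternating_dimap_def by auto
  show "(sig_1 G \<circ> sig_w G) \<circ> sig_w2 G = id" by (rule a)
  have "sig_1 G \<circ> sig_w G = inv (sig_w2 G)"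
    using a permutes_inv_o(1)[OF p] by (metis comp_assoc comp_id id_comp)
  then show "sig_w2 G \<circ> (sig_1 G \<circ> sig_w G) = id"
    using permutes_inv_o(1)[OF p] by simp
qed

lemma rotation_rotation_Head:
  assumes "alternating_dimap G"
  shows "rotation G (rotation G (Head e)) = Head (sig_1 G e)"
proof -
  have "sig_w G permutes edges G" using assms unfolding alternating_dimap_def by simp
  then show ?thesis by (simp add: inv_sig_w2[OF assms] permutes_inverses)
qed

text \<open>
  Contraction: the ends before the head and before the tail of \<open>e\<close> are linked crosswise to the
  ends after the tail and after the head. This merges the two cycles of a non-loop, splits the
  cycle of a loop, and just deletes both ends if they are adjacent, i.e. if \<open>e\<close> alone forms a face.
\<close>

lemma rotation_reduce_1:
  assumes "alternating_dimap G" and "h \<notin> {Head e, Tail e}"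
  shows "rotation (reduce_1 G e) h =
    (if rotation G h = Head e then rotation G (Tail e)
     else if rotation G h = Tail e then rotation G (Head e)
     else rotation G h)"
proof -
  have "sig_w G permutes edges G" "sig_w2 G permutes edges G"
    using assms(1) unfolding alternating_dimap_def by auto
  then have "inv (perm_del (sig_w G) e) = perm_del (inv (sig_w G)) e"
    "inv (perm_del (sig_w2 G) e) = perm_del (inv (sig_w2 G)) e"
    by (auto intro: inv_perm_del)
  then have "rotation (reduce_1 G e) h =
      (case h of Head x \<Rightarrow> Tail (perm_del (inv (sig_w G)) e x)
               | Tail x \<Rightarrow> Head (perm_del (inv (sig_w2 G)) e x))"
    by (cases h) (simp_all add: reduce_1_def)
  then show ?thesis
    using assms(2) by (cases h) (auto simp: perm_del_def)
qed

text \<open>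
  The second reduction, where \<open>g\<close> is the left successor of \<open>e\<close>: the tail of \<open>g\<close> takes the place
  of the tail of \<open>e\<close>, and the places of the head of \<open>e\<close> and of the old tail of \<open>g\<close>, which are
  adjacent, are closed up. If \<open>g = e\<close>, both ends of \<open>e\<close> are just deleted.
\<close>

lemma rotation_reduce_w:
  assumes "alternating_dimap G" and "h \<notin> {Head e, Tail e}"
    and g: "g = inv (sig_w G) e"
  shows "rotation (reduce_w G e) h =
    (let k = (if h = Tail g then rotation G (Tail e) else rotation G h)
     in if k = Head e then rotation G (Tail g) else if k = Tail e then Tail g else k)"
proof -
  let ?s = "perm_del (sig_1 G) e" and ?w = "perm_del (sig_w G) e"
  have s: "sig_1 G permutes edges G" and w: "sig_w G permutes edges G"
    using assms(1) unfolding alternating_dimap_def by auto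
  have p: "?s \<circ> ?w permutes edges G - {e}"
    using perm_del_permutes[OF s, of e] perm_del_permutes[OF w, of e]
    by (blast intro: permutes_compose)
  have wg: "sig_w G x = e \<longleftrightarrow> x = g" for x
    using g permutes_inv_eq[OF w] by metis
  have ge: "sig_w G g = e"
    using wg by simp
  have T: "rotation G (Tail y) = Head (sig_1 G (sig_w G y))" for y
    by (simp add: inv_sig_w2[OF assms(1)])
  show ?thesis
  proof (cases h)
    case (Head x)
    have "rotation (reduce_w G e) h = Tail (perm_del (inv (sig_w G)) e x)"
      using Head by (simp add: reduce_w_def inv_perm_del[OF w])
    then show ?thesis
      using Head assms(2) g by (auto simp: perm_del_def)
  next
    case (Tail x)
    have L: "rotation (reduce_w G e) h = Head (?s (?w x))"
      using Tail permutes_inv_inv[OF p] by (simp add: reduce_w_def)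
    have x: "x \<noteq> e"
      using Tail assms(2) by simp
    show ?thesis
    proof (cases "x = g")
      case True
      then have "sig_w G e \<noteq> e" using x wg by metis
      then have "?s (?w x) = (if sig_1 G (sig_w G e) = e then sig_1 G e else sig_1 G (sig_w G e))"
        using True x ge by (simp add: perm_del_def)
      with L True Tail show ?thesis by (simp add: T ge del: rotation.simps)
    next
      case False
      then have "sig_w G x \<noteq> e" using wg by simp
      then have "?s (?w x) = (if sig_1 G (sig_w G x) = e then sig_1 G e else sig_1 G (sig_w G x))"
        using x by (simp add: perm_del_def)
      with L False Tail show ?thesis by (simp add: T ge del: rotation.simps)
    qed
  qed
qed

end

theory Submission
  imports Defs
begin

text \<open>
  Both sides lose \<open>e\<close> and \<open>f\<close> from \<open>sig_w\<close>, so it suffices to compare \<open>inv sig_w2 = sig_1 \<circ> sig_w\<close>.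
  Writing \<open>s\<close>, \<open>w\<close> for \<open>sig_1\<close>, \<open>sig_w\<close>, the first permutation of \<open>G[1]e\<close> differs from \<open>s\<close> only at
  \<open>e\<close>, \<open>w e\<close> and the \<open>s\<close>-preimage of \<open>e\<close>; as \<open>f \<noteq> w e\<close>, removing \<open>f\<close> does not interfere with this.
\<close>

lemma perm_del_commute:
  assumes "inj p"
  shows "perm_del (perm_del p e) f = perm_del (perm_del p f) e"
  using inj_eq[OF assms] by (auto simp: perm_del_def fun_eq_iff)

text \<open>For \<open>s = sig_1 G\<close> and \<open>w = sig_w G\<close> the left side is
  \<open>sig_1 (reduce_1 G e)\<close>. Going back along \<open>w\<close> and then along
  \<open>s \<circ> w\<close> leaves \<open>s\<close>, with two changes: the shortcut past
  \<open>e\<close> in \<open>w\<close> turns \<open>w e\<close> into \<open>e\<close> before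
  \<open>s\<close> acts, and a value \<open>e\<close> is passed on to
  \<open>(s \<circ> w) e\<close>.\<close>

lemma perm_del_comp_inv_perm_del:
  assumes "w permutes A"
  shows "perm_del (s \<circ> w) e \<circ> inv (perm_del w e) =
    (\<lambda>x. if x = e then e
         else let y = s (if x = w e then e else x) in if y = e then s (w e) else y)"
  unfolding inv_perm_del[OF assms]
  by (auto simp: perm_del_def fun_eq_iff Let_def permutes_inverses[OF assms] permutes_inv_eq[OF assms])

text \<open>The two sides are the inverses of \<open>sig_w2\<close> for the two orders of reduction.
  On the right, contraction simply removes \<open>e\<close> from the product left by
  \<open>reduce_w G f\<close>.\<close>

lemma perm_del_product_commute:
  assumes s: "s permutes A" and w: "w permutes A" and ef: "e \<noteq> f" and fe: "f \<noteq> w e"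
  shows "perm_del (perm_del (s \<circ> w) e \<circ> inv (perm_del w e)) f \<circ> perm_del (perm_del w e) f
    = perm_del (perm_del s f \<circ> perm_del w f) e"
proof
  fix x
  define S where "S = perm_del (s \<circ> w) e \<circ> inv (perm_del w e)"
  have s_eq: "s x = s y \<longleftrightarrow> x = y" and w_eq: "w x = w y \<longleftrightarrow> x = y" for x y
    using permutes_inj[OF s] permutes_inj[OF w] by (simp_all add: inj_eq)
  note S = S_def[unfolded perm_del_comp_inv_perm_del[OF w]]
  have Se: "S e = e"
    by (simp add: S)
  have Swe: "S (w e) = (if w e = e then e else if s e = e then s (w e) else s e)"
    by (simp add: S)
  have S_other: "S y = (if s y = e then s (w e) else s y)" if "y \<noteq> e" "y \<noteq> w e" for y
    using that by (simp add: S Let_def)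
  \<comment> \<open>If \<open>f\<close> were \<open>w e\<close>, then \<open>Swe\<close> would apply
    instead and bring in \<open>s e\<close>.\<close>
  have Sf: "S f = (if s f = e then s (w e) else s f)"
    using ef fe by (simp add: S_other)
  \<comment> \<open>The cases follow whether \<open>w x\<close> must be bypassed.\<close>
  consider "x = e" | "x = f" | "x \<noteq> e" "x \<noteq> f" "w x = e" | "x \<noteq> e" "x \<noteq> f" "w x = f"
    | "x \<noteq> e" "x \<noteq> f" "w x \<noteq> e" "w x \<noteq> f"
    by blast
  then have "perm_del S f (perm_del (perm_del w e) f x) = perm_del (perm_del s f \<circ> perm_del w f) e x"
  proof cases
    case 1
    then show ?thesis using ef fe Se by (auto simp: perm_del_def)
  next
    case 2
    then show ?thesis using ef fe by (auto simp: perm_del_def)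
  next
    case 3
    \<comment> \<open>Here \<open>fe\<close> ensures that the bypass of \<open>e\<close> does not
      land on \<open>f\<close>.\<close>
    have we: "w e \<noteq> e" "w e \<noteq> f" using 3 fe w_eq by metis+
    have "perm_del (perm_del w e) f x = w e"
      using 3 we ef by (auto simp: perm_del_def)
    then show ?thesis
      using 3 ef we s_eq[of e f] s_eq[of e "w e"] s_eq[of f "w e"]
      by (auto simp: perm_del_def Sf Swe)
  next
    case 4
    have wf: "w e \<noteq> f" "w f \<noteq> f" "w f \<noteq> w e" "w f = e \<Longrightarrow> w e \<noteq> e"
      using 4 ef fe w_eq by metis+
    show ?thesis
    \<comment> \<open>Bypassing \<open>f\<close> may land on \<open>e\<close>, which is then
      bypassed as well.\<close>
    proof (cases "w f = e")
      case True
      then have "perm_del (perm_del w e) f x = w e"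
        using 4 ef by (auto simp: perm_del_def)
      then show ?thesis
        using 4 True ef wf s_eq[of e f] s_eq[of e "w e"] s_eq[of f "w e"]
        by (auto simp: perm_del_def Sf Swe)
    next
      case False
      then have "perm_del (perm_del w e) f x = w f"
        using 4 wf ef by (auto simp: perm_del_def)
      then show ?thesis
        using 4 False ef wf s_eq[of "w f" f] s_eq[of "w f" "w e"] s_eq[of f "w e"] s_eq[of e f]
        by (auto simp: perm_del_def Sf S_other)
    qed
  next
    case 5
    have wx: "w x \<noteq> w e" using 5 w_eq by metis
    have "perm_del (perm_del w e) f x = w x"
      using 5 by (auto simp: perm_del_def)
    then show ?thesis
      using 5 ef fe wx s_eq[of "w x" f] s_eq[of "w x" "w e"] s_eq[of f "w e"]
      by (auto simp: perm_del_def Sf S_other)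
  qed
  then show "(perm_del (perm_del (s \<circ> w) e \<circ> inv (perm_del w e)) f \<circ> perm_del (perm_del w e) f) x
    = perm_del (perm_del s f \<circ> perm_del w f) e x"
    by (simp add: S_def)
qed

theorem theorem11:
  fixes G :: "'a dimap" and e f :: 'a
  assumes "alternating_dimap G"
    and "e \<in> edges G" and "f \<in> edges G" and "e \<noteq> f"
    and "f \<noteq> sig_w G e"
  shows "reduce_w (reduce_1 G e) f = reduce_1 (reduce_w G f) e"
proof -
  let ?s = "sig_1 G" and ?w = "sig_w G" and ?t = "sig_w2 G"
  let ?H = "reduce_w (reduce_1 G e) f" and ?K = "reduce_1 (reduce_w G f) e"
  have s: "?s permutes edges G" and w: "?w permutes edges G" and t: "?t permutes edges G"
    using assms(1) unfolding alternating_dimap_def by auto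
  have H: "alternating_dimap ?H" and K: "alternating_dimap ?K"
    using assms(1) by (simp_all add: alternating_dimap_reduce_1 alternating_dimap_reduce_w)
  have edges: "edges ?H = edges ?K"
    by (auto simp: reduce_1_def reduce_w_def)
  have sig_w: "sig_w ?H = sig_w ?K"
    by (simp add: reduce_1_def reduce_w_def perm_del_commute[OF permutes_inj[OF w]])
  \<comment> \<open>Inverting the product reverses it, and
    \<open>inv ?t = ?s \<circ> ?w\<close>.\<close>
  have s1: "sig_1 (reduce_1 G e) = perm_del (?s \<circ> ?w) e \<circ> inv (perm_del ?w e)"
    using perm_del_permutes[OF w, of e] perm_del_permutes[OF t, of e]
    by (simp add: reduce_1_def o_inv_distrib permutes_bij inv_perm_del[OF t] inv_sig_w2[OF assms(1)])
  have p: "perm_del ?s f \<circ> perm_del ?w f permutes edges G - {f}"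
    using perm_del_permutes[OF s, of f] perm_del_permutes[OF w, of f] by (blast intro: permutes_compose)
  have "sig_1 ?H \<circ> sig_w ?H = perm_del (perm_del ?s f \<circ> perm_del ?w f) e"
    using perm_del_product_commute[OF s w assms(4,5)] s1
    by (simp add: reduce_w_def) (simp add: reduce_1_def)
  then have inv: "inv (sig_w2 ?H) = inv (sig_w2 ?K)"
    by (simp add: inv_sig_w2[OF H, symmetric])
       (simp add: reduce_1_def reduce_w_def inv_perm_del[OF permutes_inv[OF p]] permutes_inv_inv[OF p])
  have sig_w2: "sig_w2 ?H = sig_w2 ?K"
    using inv H K unfolding alternating_dimap_def by (metis permutes_inv_inv)
  have "sig_1 ?H \<circ> sig_w ?H = sig_1 ?K \<circ> sig_w ?K"
    using inv by (simp add: inv_sig_w2[OF H] inv_sig_w2[OF K])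
  \<comment> \<open>Surjectivity lets the common right factor \<open>sig_w\<close> be
    cancelled.\<close>
  moreover have "surj (sig_w ?K)"
    using K unfolding alternating_dimap_def by (blast dest: permutes_surj)
  ultimately have "sig_1 ?H = sig_1 ?K"
    unfolding sig_w by (metis comp_apply surj_fun_eq)
  then show ?thesis
    using edges sig_w sig_w2 by simp
qed

end
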